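(* Let $\Phi:\mathcal A\to R$ be an algebra homomorphism with finite expansions $$\Theta_m:=\Phi(\vartheta_m)=x^m+\sum_{n>m}a_{m,n}x^n\qquad(m\in\Lambda),$$ where $\{\vartheta_m:m\in\Lambda\}$ is a basis of $\mathcal A$. Suppose that every leading exponent $\mathrm{lead}\,g$, $0\ne g\in R$, belongs to $\Lambda$, and that for every $f\in\{1,\dots,s\}$ $$\nu_f(\Theta_m)\ge\phi_f(m)\ (m\in\Lambda),\qquad \nu_f(g)\le\phi_f(\mathrm{lead}\,g)\ (0\ne g\in R).$$ If, for every $\gamma\in\Gamma$ and every $\mathbf d\in\mathbb Z^s$, the set $$\{m\in\Lambda:q(m)=\gamma,\ \phi_f(m)\ge d_f\text{ for all }f\}$$ is finite, then $\Phi$ is an isomorphism. Moreover, for every $\mathbf d\in\mathbb Z^s$, $$R(\mathbf d)=\bigoplus_{\substack{m\in\Lambda\\ \phi_f(m)\ge d_f\ \forall f}}\mathbb C\,\Theta_m,$$ and for every finite nonzero sum $\sum_m c_m\Theta_m$ and every $f$, $$\nu_f\Bigl(\sum_m c_m\Theta_m\Bigr)=\min_{c_m\ne0}\phi_f(m).$$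
   Context: $L$ is a lattice (free abelian group of finite rank), $\mathbb C[L]$ its group algebra with monomials $x^m$, and $R\subseteq\mathbb C[L]$ a $\mathbb C$-subalgebra. Fix a total order $<$ on $L$ which is translation invariant ($m<n$ implies $m+\ell<n+\ell$). For a nonzero Laurent polynomial $g$, $\mathrm{lead}\,g$ is the least (for $<$) exponent occurring in $g$ with nonzero coefficient. $\Lambda\subseteq L$ is a subset, and $\mathcal A$ is a $\mathbb C$-algebra with $\mathbb C$-basis $\{\vartheta_m:m\in\Lambda\}$. $q:L\to\Gamma$ is a homomorphism to a lattice $\Gamma$ (a grading, with $x^m$ of degree $q(m)$); $R$ is assumed to be a graded subalgebra, and each $\Theta_m$ is assumed homogeneous of degree $q(m)$. $\nu_1,\dots,\nu_s$ are integer-valued valuations of $\mathrm{Frac}\,R$, trivial on $\mathbb C^*$, with $\nu_f(0)=+\infty$, and $\phi_f:\Lambda\to\mathbb Z$ are functions, $1\le f\le s$. For $\mathbf d=(d_1,\dots,d_s)\in\mathbb Z^s$, $R(\mathbf d)=\{g\in R:\nu_f(g)\ge d_f\text{ for every }f\}$. *)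

theory Defs
  imports
    Complex_Main
    "HOL-Library.Poly_Mapping"
    "HOL-Library.Extended"
    "HOL-Computational_Algebra.Fraction_Field"
    "HOL-Algebra.Free_Abelian_Groups"
begin

section \<open>Lattices and Laurent polynomials\<close>

text \<open>The additive group of the type \<open>'l\<close> is free abelian of finite rank.\<close>

definition is_lattice :: "'l::ab_group_add itself \<Rightarrow> bool" where
  "is_lattice _ \<longleftrightarrow>
     (\<exists>n::nat. \<lparr>carrier = (UNIV :: 'l set), monoid.mult = (+), one = 0\<rparr>
                \<cong> free_Abelian_group {..<n})"

text \<open>
  \<open>\<complex>[L]\<close> is \<open>'l \<Rightarrow>\<^sub>0 complex\<close> with the convolution product of \<open>Poly_Mapping\<close>; the monomial
  \<open>x\<^sup>m\<close> is \<open>Poly_Mapping.single m 1\<close>. The translation-invariant total order on \<open>L\<close> is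
  the one of the class \<open>linordered_ab_group_add\<close>.
\<close>

type_synonym 'l laurent = "'l \<Rightarrow>\<^sub>0 complex"

definition lconst :: "complex \<Rightarrow> 'l::zero laurent" where
  "lconst c = Poly_Mapping.single 0 c"

definition lscale :: "complex \<Rightarrow> 'l::comm_monoid_add laurent \<Rightarrow> 'l laurent" where
  "lscale c g = lconst c * g"

text \<open>Only meaningful for \<open>g \<noteq> 0\<close>.\<close>

definition lead :: "'l::linorder laurent \<Rightarrow> 'l" where
  "lead g = Min (Poly_Mapping.keys g)"

definition homogeneous_part :: "('l \<Rightarrow> 'g) \<Rightarrow> 'g \<Rightarrow> 'l laurent set" where
  "homogeneous_part q \<gamma> = {g. \<forall>m\<in>Poly_Mapping.keys g. q m = \<gamma>}"

section \<open>Complex algebras\<close>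

locale complex_algebra = vector_space scale
  for scale :: "complex \<Rightarrow> 'a::ring_1 \<Rightarrow> 'a" +
  assumes scale_mult_left: "scale c (x * y) = scale c x * y"
    and scale_mult_right: "scale c (x * y) = x * scale c y"

lemma complex_algebra_lscale:
  "complex_algebra (lscale :: complex \<Rightarrow> 'l::comm_monoid_add laurent \<Rightarrow> 'l laurent)"
  by unfold_locales
    (simp_all add: lscale_def lconst_def algebra_simps single_add mult_single
      flip: mult.assoc)

definition complex_subalgebra :: "(complex \<Rightarrow> 'a::ring_1 \<Rightarrow> 'a) \<Rightarrow> 'a set \<Rightarrow> bool" where
  "complex_subalgebra scale S \<longleftrightarrow>
     module.subspace scale S \<and> 1 \<in> S \<and> (\<forall>x\<in>S. \<forall>y\<in>S. x * y \<in> S)"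

definition complex_algebra_hom ::
    "(complex \<Rightarrow> 'a::ring_1 \<Rightarrow> 'a) \<Rightarrow> (complex \<Rightarrow> 'b::ring_1 \<Rightarrow> 'b) \<Rightarrow> 'b set \<Rightarrow> ('a \<Rightarrow> 'b) \<Rightarrow> bool" where
  "complex_algebra_hom scaleA scaleB S h \<longleftrightarrow>
     Vector_Spaces.linear scaleA scaleB h \<and> h 1 = 1 \<and> (\<forall>x y. h (x * y) = h x * h y) \<and>
     range h \<subseteq> S"

definition complex_algebra_iso ::
    "(complex \<Rightarrow> 'a::ring_1 \<Rightarrow> 'a) \<Rightarrow> (complex \<Rightarrow> 'b::ring_1 \<Rightarrow> 'b) \<Rightarrow> 'b set \<Rightarrow> ('a \<Rightarrow> 'b) \<Rightarrow> bool" where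
  "complex_algebra_iso scaleA scaleB S h \<longleftrightarrow>
     complex_algebra_hom scaleA scaleB S h \<and> bij_betw h UNIV S"

definition basis_family ::
    "(complex \<Rightarrow> 'a::ab_group_add \<Rightarrow> 'a) \<Rightarrow> 'i set \<Rightarrow> ('i \<Rightarrow> 'a) \<Rightarrow> bool" where
  "basis_family scale I b \<longleftrightarrow>
     inj_on b I \<and> \<not> module.dependent scale (b ` I) \<and> module.span scale (b ` I) = UNIV"

text \<open>
  Internal direct sum of a family \<open>W\<close> of subgroups: the members are the finite sums, and
  a finite sum vanishes only if every summand does.
\<close>

definition is_direct_sum :: "'i set \<Rightarrow> ('i \<Rightarrow> 'b::ab_group_add set) \<Rightarrow> 'b set \<Rightarrow> bool" where
  "is_direct_sum I W V \<longleftrightarrow>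
     V = {\<Sum>i\<in>S. w i | S w. finite S \<and> S \<subseteq> I \<and> (\<forall>i\<in>S. w i \<in> W i)} \<and>
     (\<forall>S w. finite S \<and> S \<subseteq> I \<and> (\<forall>i\<in>S. w i \<in> W i) \<and> (\<Sum>i\<in>S. w i) = 0
        \<longrightarrow> (\<forall>i\<in>S. w i = 0))"

section \<open>Valuations\<close>

text \<open>The fraction field of a subring, realised inside the fraction field of the ambient domain.\<close>

definition Frac :: "'b::idom set \<Rightarrow> 'b fract set" where
  "Frac S = {Fract a b | a b. a \<in> S \<and> b \<in> S \<and> b \<noteq> 0}"

text \<open>\<open>v\<close> is constrained only on the subfield \<open>K\<close>; its values elsewhere are junk.\<close>

definition int_valuation_on :: "'k::field set \<Rightarrow> ('k \<Rightarrow> int extended) \<Rightarrow> bool" where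
  "int_valuation_on K v \<longleftrightarrow>
     v 0 = \<infinity> \<and>
     (\<forall>x\<in>K. x \<noteq> 0 \<longrightarrow> v x \<in> range Fin) \<and>
     (\<forall>x\<in>K. \<forall>y\<in>K. v (x * y) = v x + v y) \<and>
     (\<forall>x\<in>K. \<forall>y\<in>K. min (v x) (v y) \<le> v (x + y))"

definition trivial_on_constants ::
    "('l::linordered_ab_group_add laurent fract \<Rightarrow> int extended) \<Rightarrow> bool" where
  "trivial_on_constants v \<longleftrightarrow> (\<forall>c. c \<noteq> 0 \<longrightarrow> v (Fract (lconst c) 1) = 0)"

definition R_ge ::
    "'l::linordered_ab_group_add laurent set \<Rightarrow> nat
      \<Rightarrow> (nat \<Rightarrow> 'l laurent fract \<Rightarrow> int extended) \<Rightarrow> (nat \<Rightarrow> int) \<Rightarrow> 'l laurent set" where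
  "R_ge R s \<nu> d = {g \<in> R. \<forall>f\<in>{1..s}. \<nu> f (Fract g 1) \<ge> Fin (d f)}"

end

theory Submission
  imports Defs
begin

text \<open>
  All assertions come from one peeling step. If \<open>g \<in> R\<close> is nonzero with leading coefficient \<open>c\<close> at
  \<open>m = lead g\<close>, then \<open>m \<in> \<Lambda>\<close>, and \<open>g - c \<Theta>\<^sub>m\<close> either vanishes or has a strictly larger leading
  exponent. Moreover \<open>\<nu>\<^sub>f(g) \<ge> d\<close> forces \<open>\<phi>\<^sub>f(m) \<ge> \<nu>\<^sub>f(g) \<ge> d\<close>, hence \<open>\<nu>\<^sub>f(\<Theta>\<^sub>m) \<ge> d\<close> and
  \<open>\<nu>\<^sub>f(g - c \<Theta>\<^sub>m) \<ge> d\<close>: peeling never leaves a subspace cut out by lower bounds on the \<open>\<nu>\<^sub>f\<close>.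

  This is used twice. If \<open>g\<close> is homogeneous of degree \<open>\<gamma>\<close> and \<open>d\<^sub>f = \<nu>\<^sub>f(g)\<close>, all exponents met while
  peeling lie in the finite set \<open>{m \<in> \<Lambda>. q m = \<gamma> \<and> (\<forall>f. \<phi>\<^sub>f(m) \<ge> d\<^sub>f)}\<close>; as they increase strictly, the
  process stops and \<open>g\<close> is a combination of the \<open>\<Theta>\<^sub>m\<close> (\<open>peel_finite\<close>). Since \<open>R\<close> is graded, the
  \<open>\<Theta>\<^sub>m\<close> span \<open>R\<close>, and distinct leading exponents make them independent, so \<open>\<Phi>\<close> is bijective.
  If, on the other hand, a finite sum \<open>g = \<Sum>\<^sub>m c\<^sub>m \<Theta>\<^sub>m\<close> is given, peeling removes its terms one
  after the other, so every \<open>m\<close> with \<open>c\<^sub>m \<noteq> 0\<close> satisfies \<open>\<phi>\<^sub>f(m) \<ge> \<nu>\<^sub>f(g)\<close> (\<open>peel_sum\<close>); this is the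
  nontrivial half of the formula for \<open>\<nu>\<^sub>f(g)\<close>, and it also identifies \<open>R(d)\<close>.
\<close>

section \<open>Finite combinations of a family\<close>

lemma (in module) span_imageE:
  assumes "x \<in> span (b ` I)"
  obtains S c where "finite S" "S \<subseteq> I" "\<forall>i\<in>S. c i \<noteq> 0" "x = (\<Sum>i\<in>S. c i *s b i)"
proof -
  obtain t r where t: "finite t" "t \<subseteq> b ` I" and x: "x = (\<Sum>a\<in>t. r a *s a)"
    using assms by (auto simp: span_explicit)
  obtain S where S: "S \<subseteq> I" "inj_on b S" "t = b ` S"
    using t(2) by (auto simp: subset_image_inj)
  have "finite S" using t(1) S by (simp add: finite_image_iff)
  have "x = (\<Sum>i\<in>S. r (b i) *s b i)"
    unfolding x S(3) by (simp add: sum.reindex[OF S(2)])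
  also have "\<dots> = (\<Sum>i\<in>{i \<in> S. r (b i) \<noteq> 0}. r (b i) *s b i)"
    by (rule sum.mono_neutral_right) (use \<open>finite S\<close> in auto)
  finally have x_eq: "x = (\<Sum>i\<in>{i \<in> S. r (b i) \<noteq> 0}. r (b i) *s b i)" .
  show thesis
    by (rule that[OF _ _ _ x_eq]) (use \<open>finite S\<close> S(1) in auto)
qed

section \<open>Families with prescribed leading exponents\<close>

interpretation laurent: complex_algebra "lscale :: complex \<Rightarrow> 'l::comm_monoid_add laurent \<Rightarrow> 'l laurent"
  by (rule complex_algebra_lscale)

lemma lookup_lscale: "Poly_Mapping.lookup (lscale c g) n = c * Poly_Mapping.lookup g n"
  unfolding lscale_def lconst_def mult_map_scale_conv_mult[symmetric]
  by (simp add: map.rep_eq when_def)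

lemma lookup_less_lead: "n < lead g \<Longrightarrow> Poly_Mapping.lookup g n = 0"
  unfolding lead_def by (metis Min_le finite_keys in_keys_iff leD)

lemma lookup_lead: "g \<noteq> 0 \<Longrightarrow> Poly_Mapping.lookup g (lead g) \<noteq> 0"
  unfolding lead_def by (metis Min_in finite_keys in_keys_iff keys_eq_empty)

text \<open>\<open>g\<close> is \<open>x\<^sup>m\<close> plus terms with exponents greater than \<open>m\<close>.\<close>

definition monic_at :: "'l::linorder \<Rightarrow> 'l laurent \<Rightarrow> bool" where
  "monic_at m g \<longleftrightarrow> Poly_Mapping.lookup g m = 1 \<and> (\<forall>n<m. Poly_Mapping.lookup g n = 0)"

lemma lead_monic_sum:
  assumes T: "\<And>m. m \<in> S \<Longrightarrow> monic_at m (T m)"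
    and S: "finite S" "S \<noteq> {}" "\<And>m. m \<in> S \<Longrightarrow> c m \<noteq> 0"
  defines "g \<equiv> \<Sum>m\<in>S. lscale (c m) (T m)"
  shows "g \<noteq> 0" and "lead g = Min S"
proof -
  let ?k = "Min S"
  have k: "?k \<in> S" and min: "\<And>m. m \<in> S \<Longrightarrow> ?k \<le> m"
    using S by auto
  have lookup_g: "Poly_Mapping.lookup g n = (\<Sum>m\<in>S. c m * Poly_Mapping.lookup (T m) n)" for n
    by (simp add: g_def lookup_sum lookup_lscale)
  have "Poly_Mapping.lookup g ?k = (\<Sum>m\<in>{?k}. c m * Poly_Mapping.lookup (T m) ?k)"
    unfolding lookup_g
    by (rule sum.mono_neutral_right) (use k S min T in \<open>auto simp: monic_at_def less_le\<close>)
  also have "\<dots> \<noteq> 0"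
    using S(3)[OF k] T[OF k] by (simp add: monic_at_def)
  finally have nz: "Poly_Mapping.lookup g ?k \<noteq> 0" .
  then show "g \<noteq> 0" by auto
  have "Poly_Mapping.lookup g n = 0" if "n < ?k" for n
    unfolding lookup_g
  proof (rule sum.neutral, rule ballI)
    fix m assume "m \<in> S"
    then have "n < m" using that min[of m] by simp
    then show "c m * Poly_Mapping.lookup (T m) n = 0"
      using T[OF \<open>m \<in> S\<close>] by (simp add: monic_at_def)
  qed
  with nz show "lead g = ?k"
    by (metis \<open>g \<noteq> 0\<close> lookup_lead lookup_less_lead not_less_iff_gr_or_eq)
qed

lemma monic_sum_eq_0_iff:
  assumes T: "\<And>m. m \<in> S \<Longrightarrow> monic_at m (T m)" and S: "finite S"
  shows "(\<Sum>m\<in>S. lscale (c m) (T m)) = 0 \<longleftrightarrow> (\<forall>m\<in>S. c m = 0)"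
proof -
  let ?S = "{m \<in> S. c m \<noteq> 0}"
  have sum_eq: "(\<Sum>m\<in>S. lscale (c m) (T m)) = (\<Sum>m\<in>?S. lscale (c m) (T m))"
    by (rule sum.mono_neutral_right) (use S in auto)
  show ?thesis
  proof (cases "?S = {}")
    case True
    then show ?thesis by simp
  next
    case False
    have "(\<Sum>m\<in>?S. lscale (c m) (T m)) \<noteq> 0"
      by (rule lead_monic_sum(1)) (use T S False in simp_all)
    then show ?thesis using sum_eq False by auto
  qed
qed

lemma lead_diff_less:
  assumes T: "monic_at (lead g) T"
  defines "h \<equiv> g - lscale (Poly_Mapping.lookup g (lead g)) T"
  assumes h: "h \<noteq> 0"
  shows "lead g < lead h"
proof -
  have "Poly_Mapping.lookup h n = 0" if "n \<le> lead g" for n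
    using that T lookup_less_lead[of n g]
    by (cases "n = lead g") (auto simp: h_def lookup_minus lookup_lscale monic_at_def)
  then show ?thesis
    using lookup_lead[OF h] by (meson not_le)
qed

section \<open>Peeling off leading terms\<close>

text \<open>
  The set \<open>M\<close> controls the leading exponents of the subspace \<open>V\<close>, which contains the elements
  \<open>T m\<close> needed to peel them off. Finiteness of \<open>M\<close> makes the process stop.
\<close>

lemma peel_finite:
  assumes V: "laurent.subspace V"
    and M: "finite M" "\<And>g. g \<in> V \<Longrightarrow> g \<noteq> 0 \<Longrightarrow> lead g \<in> M"
    and T: "\<And>m. m \<in> M \<Longrightarrow> T m \<in> V" "\<And>m. m \<in> M \<Longrightarrow> monic_at m (T m)"
    and g: "g \<in> V"
  shows "g \<in> laurent.span (T ` M)"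
  using g
proof (induction "card {m \<in> M. lead g \<le> m}" arbitrary: g rule: less_induct)
  case less
  show ?case
  proof (cases "g = 0")
    case True
    then show ?thesis by (simp add: laurent.span_zero)
  next
    case False
    define k where "k = lead g"
    define h where "h = g - lscale (Poly_Mapping.lookup g k) (T k)"
    have k: "k \<in> M" using M(2) less.prems False by (simp add: k_def)
    have hV: "h \<in> V"
      unfolding h_def using V less.prems T(1)[OF k]
      by (intro laurent.subspace_diff laurent.subspace_scale)
    have "h \<in> laurent.span (T ` M)"
    proof (cases "h = 0")
      case True
      then show ?thesis by (simp add: laurent.span_zero)
    next
      case h: False
      have "k < lead h"
        using lead_diff_less[of g "T k"] T(2)[OF k] h by (simp add: k_def h_def)
      then have "{m \<in> M. lead h \<le> m} \<subset> {m \<in> M. lead g \<le> m}"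
        using k less_le_not_le[of k "lead h"] by (fastforce simp: k_def)
      then show ?thesis
        using less.hyps[of h] hV M(1) by (simp add: psubset_card_mono)
    qed
    moreover have "g = h + lscale (Poly_Mapping.lookup g k) (T k)"
      by (simp add: h_def)
    ultimately show ?thesis
      using k by (metis imageI laurent.span_add laurent.span_base laurent.span_scale)
  qed
qed

text \<open>
  Without any finiteness of \<open>M\<close>: a combination that lies in \<open>V\<close> involves exponents from \<open>M\<close> only.
  Its leading exponent \<open>Min S\<close> lies in \<open>M\<close>, so that term can be removed inside \<open>V\<close>.
\<close>

lemma peel_sum:
  assumes V: "laurent.subspace V"
    and M: "\<And>g. g \<in> V \<Longrightarrow> g \<noteq> 0 \<Longrightarrow> lead g \<in> M"
    and T: "\<And>m. m \<in> M \<Longrightarrow> T m \<in> V"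
    and S: "finite S" "\<And>m. m \<in> S \<Longrightarrow> monic_at m (T m)" "\<And>m. m \<in> S \<Longrightarrow> c m \<noteq> 0"
    and g: "(\<Sum>m\<in>S. lscale (c m) (T m)) \<in> V"
  shows "S \<subseteq> M"
  using S g
proof (induction "card S" arbitrary: S rule: less_induct)
  case less
  show ?case
  proof (cases "S = {}")
    case False
    let ?k = "Min S"
    have k: "?k \<in> S" using False less.prems(1) by simp
    have kM: "?k \<in> M"
      using lead_monic_sum[OF less.prems(2,1) False less.prems(3)] M[OF less.prems(4)] by simp
    have "(\<Sum>m\<in>S - {?k}. lscale (c m) (T m))
        = (\<Sum>m\<in>S. lscale (c m) (T m)) - lscale (c ?k) (T ?k)"
      using k less.prems(1) by (simp add: sum_diff1)
    also have "\<dots> \<in> V"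
      using V less.prems(4) T[OF kM] by (intro laurent.subspace_diff laurent.subspace_scale)
    finally have "S - {?k} \<subseteq> M"
      using less.hyps[of "S - {?k}"] less.prems k card_Diff1_less[of S ?k] by simp
    then show ?thesis using kM by auto
  qed simp
qed

section \<open>Subspaces defined by valuations and gradings\<close>

lemma subspace_homogeneous_part: "laurent.subspace (homogeneous_part q \<gamma>)"
  by (fastforce simp: laurent.subspace_def homogeneous_part_def in_keys_iff lookup_lscale lookup_add)

lemma Fract_in_Frac: "g \<in> R \<Longrightarrow> 1 \<in> R \<Longrightarrow> Fract g 1 \<in> Frac R"
  unfolding Frac_def mem_Collect_eq by (intro exI[of _ g] exI[of _ 1]) simp

lemma lscale_one: "lscale c 1 = lconst c"
  by (simp add: lscale_def)

lemma int_valuation_on_add: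
  "int_valuation_on K v \<Longrightarrow> x \<in> K \<Longrightarrow> y \<in> K \<Longrightarrow> min (v x) (v y) \<le> v (x + y)"
  unfolding int_valuation_on_def by simp

lemma int_valuation_on_mult:
  "int_valuation_on K v \<Longrightarrow> x \<in> K \<Longrightarrow> y \<in> K \<Longrightarrow> v (x * y) = v x + v y"
  unfolding int_valuation_on_def by simp

lemma R_ge_iff:
  "g \<in> R_ge R s \<nu> d \<longleftrightarrow> g \<in> R \<and> (\<forall>f\<in>{1..s}. Fin (d f) \<le> \<nu> f (Fract g 1))"
  unfolding R_ge_def by (rule mem_Collect_eq)

lemma subspace_R_ge:
  fixes R :: "'l::linordered_ab_group_add laurent set"
  assumes R: "complex_subalgebra lscale R"
    and val: "\<And>f. f \<in> {1..s} \<Longrightarrow> int_valuation_on (Frac R) (\<nu> f)"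
    and triv: "\<And>f. f \<in> {1..s} \<Longrightarrow> trivial_on_constants (\<nu> f)"
  shows "laurent.subspace (R_ge R s \<nu> d)"
proof -
  have RS: "laurent.subspace R" and one: "1 \<in> R"
    using R by (auto simp: complex_subalgebra_def)
  note Frac = Fract_in_Frac[OF _ one]
  show ?thesis
    unfolding laurent.subspace_def
  proof (intro conjI ballI allI)
    show "0 \<in> R_ge R s \<nu> d"
      using val laurent.subspace_0[OF RS]
      by (auto simp: R_ge_def int_valuation_on_def fract_collapse)
  next
    fix g h assume gh: "g \<in> R_ge R s \<nu> d" "h \<in> R_ge R s \<nu> d"
    then have R': "g \<in> R" "h \<in> R" unfolding R_ge_iff by blast+
    have "Fin (d f) \<le> \<nu> f (Fract (g + h) 1)" if f: "f \<in> {1..s}" for f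
    proof -
      have "Fin (d f) \<le> min (\<nu> f (Fract g 1)) (\<nu> f (Fract h 1))"
        using gh f unfolding R_ge_iff by (intro min.boundedI) blast+
      also have "\<dots> \<le> \<nu> f (Fract g 1 + Fract h 1)"
        by (rule int_valuation_on_add[OF val[OF f] Frac Frac]) (fact R')+
      also have "Fract g 1 + Fract h 1 = Fract (g + h) 1" by simp
      finally show ?thesis .
    qed
    then show "g + h \<in> R_ge R s \<nu> d"
      using laurent.subspace_add[OF RS] R' unfolding R_ge_iff by blast
  next
    fix c :: complex and g assume g: "g \<in> R_ge R s \<nu> d"
    then have R': "g \<in> R" unfolding R_ge_iff by blast
    have cR: "lconst c \<in> R"
      using laurent.subspace_scale[OF RS one, of c] by (simp add: lscale_one)
    have "Fin (d f) \<le> \<nu> f (Fract (lscale c g) 1)" if f: "f \<in> {1..s}" for f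
    proof (cases "c = 0")
      case True
      then show ?thesis
        using val[OF f] by (simp add: int_valuation_on_def fract_collapse)
    next
      case False
      have "\<nu> f (Fract (lscale c g) 1) = \<nu> f (Fract (lconst c) 1 * Fract g 1)"
        by (simp add: lscale_def)
      also have "\<dots> = \<nu> f (Fract (lconst c) 1) + \<nu> f (Fract g 1)"
        by (rule int_valuation_on_mult[OF val[OF f] Frac[OF cR] Frac[OF R']])
      also have "\<dots> = \<nu> f (Fract g 1)"
        using triv[OF f] False by (simp add: trivial_on_constants_def)
      finally show ?thesis using g f unfolding R_ge_iff by simp
    qed
    then show "lscale c g \<in> R_ge R s \<nu> d"
      using laurent.subspace_scale[OF RS] R' unfolding R_ge_iff by blast
  qed
qed

lemma monic_at_expansion:
  fixes m :: "'l::linordered_ab_group_add"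
  shows "monic_at m (Poly_Mapping.single m 1
          + (\<Sum>n\<in>{n. n > m \<and> a n \<noteq> 0}. lscale (a n) (Poly_Mapping.single n 1)))"
  by (auto simp: monic_at_def lookup_add lookup_sum lookup_lscale lookup_single when_def
      intro!: sum.neutral)

section \<open>Bases adapted to valuations\<close>

theorem theorem5p2:
  fixes R :: "'l::linordered_ab_group_add laurent set"
    and \<Lambda> :: "'l set"
    and scale :: "complex \<Rightarrow> 'a::ring_1 \<Rightarrow> 'a"
    and \<theta> :: "'l \<Rightarrow> 'a"
    and q :: "'l \<Rightarrow> 'g::ab_group_add"
    and s :: nat
    and \<nu> :: "nat \<Rightarrow> 'l laurent fract \<Rightarrow> int extended"
    and \<phi> :: "nat \<Rightarrow> 'l \<Rightarrow> int"
    and \<Phi> :: "'a \<Rightarrow> 'l laurent"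
    and \<Theta> :: "'l \<Rightarrow> 'l laurent"
    and a :: "'l \<Rightarrow> 'l \<Rightarrow> complex"
  assumes L: "is_lattice TYPE('l)"
    and \<Gamma>: "is_lattice TYPE('g)"
    and q: "additive q"
    and R: "complex_subalgebra lscale R"
    and R_graded: "is_direct_sum UNIV (\<lambda>\<gamma>. R \<inter> homogeneous_part q \<gamma>) R"
    and A: "complex_algebra scale"
    and basis: "basis_family scale \<Lambda> \<theta>"
    and valuation: "\<And>f. f \<in> {1..s} \<Longrightarrow> int_valuation_on (Frac R) (\<nu> f)"
    and triv: "\<And>f. f \<in> {1..s} \<Longrightarrow> trivial_on_constants (\<nu> f)"
    and \<Phi>: "complex_algebra_hom scale lscale R \<Phi>"
    and \<Theta>: "\<And>m. m \<in> \<Lambda> \<Longrightarrow> \<Theta> m = \<Phi> (\<theta> m)"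
    and expansion_finite: "\<And>m. m \<in> \<Lambda> \<Longrightarrow> finite {n. n > m \<and> a m n \<noteq> 0}"
    and expansion: "\<And>m. m \<in> \<Lambda> \<Longrightarrow> \<Theta> m = Poly_Mapping.single m 1
          + (\<Sum>n\<in>{n. n > m \<and> a m n \<noteq> 0}. lscale (a m n) (Poly_Mapping.single n 1))"
    and \<Theta>_homogeneous: "\<And>m. m \<in> \<Lambda> \<Longrightarrow> \<Theta> m \<in> homogeneous_part q (q m)"
    and lead_in: "\<And>g. g \<in> R \<Longrightarrow> g \<noteq> 0 \<Longrightarrow> lead g \<in> \<Lambda>"
    and \<nu>_ge: "\<And>f m. f \<in> {1..s} \<Longrightarrow> m \<in> \<Lambda> \<Longrightarrow> \<nu> f (Fract (\<Theta> m) 1) \<ge> Fin (\<phi> f m)"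
    and \<nu>_le: "\<And>f g. f \<in> {1..s} \<Longrightarrow> g \<in> R \<Longrightarrow> g \<noteq> 0 \<Longrightarrow> \<nu> f (Fract g 1) \<le> Fin (\<phi> f (lead g))"
    and fin: "\<And>\<gamma> (d :: nat \<Rightarrow> int).
          finite {m \<in> \<Lambda>. q m = \<gamma> \<and> (\<forall>f\<in>{1..s}. \<phi> f m \<ge> d f)}"
  shows "complex_algebra_iso scale lscale R \<Phi>
    \<and> (\<forall>d :: nat \<Rightarrow> int.
          is_direct_sum {m \<in> \<Lambda>. \<forall>f\<in>{1..s}. \<phi> f m \<ge> d f}
            (\<lambda>m. {lscale c (\<Theta> m) | c. True}) (R_ge R s \<nu> d))
    \<and> (\<forall>S c. finite S \<and> S \<subseteq> \<Lambda> \<and> (\<Sum>m\<in>S. lscale (c m) (\<Theta> m)) \<noteq> 0 \<longrightarrow>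
          (\<forall>f\<in>{1..s}. \<nu> f (Fract (\<Sum>m\<in>S. lscale (c m) (\<Theta> m)) 1)
                        = Fin (Min {\<phi> f m | m. m \<in> S \<and> c m \<noteq> 0})))"
proof -
  have R_sub: "laurent.subspace R"
    using R by (simp add: complex_subalgebra_def)
  have \<Phi>_lin: "Vector_Spaces.linear scale lscale \<Phi>" and \<Phi>_R: "range \<Phi> \<subseteq> R"
    using \<Phi> by (auto simp: complex_algebra_hom_def)
  interpret A: complex_algebra scale by (rule A)
  interpret \<Phi>: Vector_Spaces.linear scale lscale \<Phi> by (rule \<Phi>_lin)
  have monic: "monic_at m (\<Theta> m)" if "m \<in> \<Lambda>" for m
    unfolding expansion[OF that] by (rule monic_at_expansion)
  have indep: "\<forall>m\<in>S. c m = 0"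
    if "finite S" "S \<subseteq> \<Lambda>" "(\<Sum>m\<in>S. lscale (c m) (\<Theta> m)) = 0" for S c
    using monic_sum_eq_0_iff[of S \<Theta> c] monic that by blast
  have \<Theta>_R: "\<Theta> m \<in> R" if "m \<in> \<Lambda>" for m
    using \<Phi>_R \<Theta>[OF that] by auto
  have sub_ge: "laurent.subspace (R_ge R s \<nu> d)" for d
    by (rule subspace_R_ge[OF R valuation triv])
  have \<Theta>_ge: "\<Theta> m \<in> R_ge R s \<nu> d" if "m \<in> \<Lambda>" "\<forall>f\<in>{1..s}. \<phi> f m \<ge> d f" for m d
  proof -
    have "Fin (d f) \<le> \<nu> f (Fract (\<Theta> m) 1)" if f: "f \<in> {1..s}" for f
      by (rule order_trans[OF _ \<nu>_ge[OF f \<open>m \<in> \<Lambda>\<close>]]) (use that f \<open>\<forall>f\<in>{1..s}. d f \<le> \<phi> f m\<close> in simp)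
    then show ?thesis
      using \<Theta>_R[OF that(1)] by (simp add: R_ge_iff)
  qed
  have lead_ge: "lead g \<in> {m \<in> \<Lambda>. \<forall>f\<in>{1..s}. \<phi> f m \<ge> d f}"
    if "g \<in> R_ge R s \<nu> d" "g \<noteq> 0" for g d
  proof -
    have "Fin (d f) \<le> Fin (\<phi> f (lead g))" if f: "f \<in> {1..s}" for f
      by (rule order_trans[OF _ \<nu>_le[OF f]]) (use \<open>g \<in> _\<close> \<open>g \<noteq> 0\<close> f in \<open>auto simp: R_ge_def\<close>)
    then show ?thesis
      using lead_in that by (auto simp: R_ge_iff)
  qed

  have homogeneous_span: "g \<in> laurent.span (\<Theta> ` \<Lambda>)" if g: "g \<in> R \<inter> homogeneous_part q \<gamma>" for g \<gamma>
  proof (cases "g = 0")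
    case True
    then show ?thesis by (simp add: laurent.span_zero)
  next
    case False
    have "\<exists>k. \<nu> f (Fract g 1) = Fin k" if f: "f \<in> {1..s}" for f
    proof -
      have "Fract g 1 \<in> Frac R"
        using g R by (intro Fract_in_Frac) (auto simp: complex_subalgebra_def)
      moreover have "Fract g 1 \<noteq> 0"
        using False by (simp add: Zero_fract_def eq_fract)
      ultimately have "\<nu> f (Fract g 1) \<in> range Fin"
        using valuation[OF f] unfolding int_valuation_on_def by blast
      then show ?thesis by auto
    qed
    then obtain d where d: "\<And>f. f \<in> {1..s} \<Longrightarrow> \<nu> f (Fract g 1) = Fin (d f)"
      by metis
    \<comment> \<open>Bounding every \<open>\<nu> f\<close> by its value at \<open>g\<close> keeps \<open>g\<close> in \<open>?V\<close> and makes \<open>?M\<close> finite.\<close>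
    let ?V = "R_ge R s \<nu> d \<inter> homogeneous_part q \<gamma>"
    let ?M = "{m \<in> \<Lambda>. q m = \<gamma> \<and> (\<forall>f\<in>{1..s}. \<phi> f m \<ge> d f)}"
    have "g \<in> laurent.span (\<Theta> ` ?M)"
    proof (rule peel_finite[where V = ?V])
      show "laurent.subspace ?V"
        by (intro laurent.subspace_inter sub_ge subspace_homogeneous_part)
      show "g \<in> ?V"
        using g d by (auto simp: R_ge_iff)
      show "lead h \<in> ?M" if "h \<in> ?V" "h \<noteq> 0" for h
        using lead_ge[of h d] lookup_lead[of h] that
        by (auto simp: homogeneous_part_def in_keys_iff)
      show "\<Theta> m \<in> ?V" if "m \<in> ?M" for m
        using \<Theta>_ge[of m d] \<Theta>_homogeneous[of m] that by auto
    qed (use fin monic in auto)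
    then show ?thesis
      using laurent.span_mono[of "\<Theta> ` ?M" "\<Theta> ` \<Lambda>"] by auto
  qed
  have R_span: "R \<subseteq> laurent.span (\<Theta> ` \<Lambda>)"
  proof
    fix g assume "g \<in> R"
    then obtain S w where g: "g = (\<Sum>\<gamma>\<in>S. w \<gamma>)" and w: "\<forall>\<gamma>\<in>S. w \<gamma> \<in> R \<inter> homogeneous_part q \<gamma>"
      using R_graded unfolding is_direct_sum_def by blast
    then show "g \<in> laurent.span (\<Theta> ` \<Lambda>)"
      unfolding g using homogeneous_span by (intro laurent.span_sum) blast
  qed

  have \<theta>_span: "A.span (\<theta> ` \<Lambda>) = UNIV"
    using basis by (simp add: basis_family_def)
  have "range \<Phi> = R"
  proof
    have "\<Phi> ` \<theta> ` \<Lambda> = \<Theta> ` \<Lambda>"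
      unfolding image_image using \<Theta> by (intro image_cong) simp_all
    then show "R \<subseteq> range \<Phi>"
      using R_span \<Phi>.span_image[of "\<theta> ` \<Lambda>"] \<theta>_span by simp
  qed (rule \<Phi>_R)
  moreover have "inj \<Phi>"
    unfolding \<Phi>.inj_iff_eq_0
  proof (intro allI impI)
    fix x assume x: "\<Phi> x = 0"
    have "x \<in> A.span (\<theta> ` \<Lambda>)" by (simp add: \<theta>_span)
    then obtain S c where S: "finite S" "S \<subseteq> \<Lambda>" and c: "\<forall>m\<in>S. c m \<noteq> 0"
      and x_eq: "x = (\<Sum>m\<in>S. scale (c m) (\<theta> m))"
      by (rule A.span_imageE)
    have "\<Phi> x = (\<Sum>m\<in>S. lscale (c m) (\<Theta> m))"
      unfolding x_eq \<Phi>.sum \<Phi>.scale using S \<Theta> by (intro sum.cong) auto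
    then have "\<forall>m\<in>S. c m = 0"
      using x indep[OF S, of c] by simp
    with c have "S = {}" by auto
    then show "x = 0" by (simp add: x_eq)
  qed
  ultimately have iso: "complex_algebra_iso scale lscale R \<Phi>"
    using \<Phi> by (simp add: complex_algebra_iso_def bij_betw_def)

  have sum_ge: "S \<subseteq> {m \<in> \<Lambda>. \<forall>f\<in>{1..s}. \<phi> f m \<ge> d f}"
    if "finite S" "S \<subseteq> \<Lambda>" "\<forall>m\<in>S. c m \<noteq> 0"
      and "(\<Sum>m\<in>S. lscale (c m) (\<Theta> m)) \<in> R_ge R s \<nu> d" for S c d
  proof (rule peel_sum[where V = "R_ge R s \<nu> d" and T = \<Theta> and c = c])
    show "lead g \<in> {m \<in> \<Lambda>. \<forall>f\<in>{1..s}. \<phi> f m \<ge> d f}" if "g \<in> R_ge R s \<nu> d" "g \<noteq> 0" for g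
      by (rule lead_ge[OF that])
    show "\<Theta> m \<in> R_ge R s \<nu> d" if "m \<in> {m \<in> \<Lambda>. \<forall>f\<in>{1..s}. \<phi> f m \<ge> d f}" for m
      using that \<Theta>_ge by blast
  qed (use that monic sub_ge in blast)+

  have direct: "is_direct_sum {m \<in> \<Lambda>. \<forall>f\<in>{1..s}. \<phi> f m \<ge> d f}
      (\<lambda>m. {lscale c (\<Theta> m) | c. True}) (R_ge R s \<nu> d)" for d
    unfolding is_direct_sum_def
  proof (intro conjI allI impI)
    let ?M = "{m \<in> \<Lambda>. \<forall>f\<in>{1..s}. \<phi> f m \<ge> d f}"
    let ?W = "\<lambda>m. {lscale c (\<Theta> m) | c. True}"
    show "R_ge R s \<nu> d = {\<Sum>i\<in>S. w i | S w. finite S \<and> S \<subseteq> ?M \<and> (\<forall>i\<in>S. w i \<in> ?W i)}"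
    proof (intro equalityI subsetI)
      fix g assume g: "g \<in> R_ge R s \<nu> d"
      then have "g \<in> laurent.span (\<Theta> ` \<Lambda>)" using R_span by (auto simp: R_ge_iff)
      then obtain S c where S: "finite S" "S \<subseteq> \<Lambda>" "\<forall>m\<in>S. c m \<noteq> 0"
        and g_eq: "g = (\<Sum>m\<in>S. lscale (c m) (\<Theta> m))"
        by (rule laurent.span_imageE)
      have "S \<subseteq> ?M" using sum_ge[OF S] g g_eq by blast
      with S(1) g_eq show "g \<in> {\<Sum>i\<in>S. w i | S w. finite S \<and> S \<subseteq> ?M \<and> (\<forall>i\<in>S. w i \<in> ?W i)}"
        by blast
    next
      fix g assume "g \<in> {\<Sum>i\<in>S. w i | S w. finite S \<and> S \<subseteq> ?M \<and> (\<forall>i\<in>S. w i \<in> ?W i)}"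
      then obtain S w where "S \<subseteq> ?M" and w: "\<forall>i\<in>S. w i \<in> ?W i" and g: "g = (\<Sum>i\<in>S. w i)"
        by blast
      have "w i \<in> R_ge R s \<nu> d" if "i \<in> S" for i
        using w that \<open>S \<subseteq> ?M\<close> \<Theta>_ge[of i d] laurent.subspace_scale[OF sub_ge] by fastforce
      then show "g \<in> R_ge R s \<nu> d"
        unfolding g by (rule laurent.subspace_sum[OF sub_ge])
    qed
    fix S w assume "finite S \<and> S \<subseteq> ?M \<and> (\<forall>i\<in>S. w i \<in> ?W i) \<and> (\<Sum>i\<in>S. w i) = 0"
    then have S: "finite S" "S \<subseteq> \<Lambda>" and w: "\<forall>i\<in>S. \<exists>c. w i = lscale c (\<Theta> i)"
      and sum0: "(\<Sum>i\<in>S. w i) = 0" by auto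
    obtain c where c: "\<And>i. i \<in> S \<Longrightarrow> w i = lscale (c i) (\<Theta> i)"
      using w by metis
    have "(\<Sum>i\<in>S. lscale (c i) (\<Theta> i)) = 0"
      using sum0 c by simp
    from indep[OF S this] show "\<forall>i\<in>S. w i = 0" using c by simp
  qed

  have min: "\<nu> f (Fract (\<Sum>m\<in>S. lscale (c m) (\<Theta> m)) 1)
      = Fin (Min {\<phi> f m | m. m \<in> S \<and> c m \<noteq> 0})"
    if S: "finite S" "S \<subseteq> \<Lambda>" and nz: "(\<Sum>m\<in>S. lscale (c m) (\<Theta> m)) \<noteq> 0" and f: "f \<in> {1..s}"
    for S c f
  proof -
    let ?S = "{m \<in> S. c m \<noteq> 0}"
    define g where "g = (\<Sum>m\<in>S. lscale (c m) (\<Theta> m))"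
    define \<mu> where "\<mu> = Min {\<phi> f m | m. m \<in> S \<and> c m \<noteq> 0}"
    have g: "g = (\<Sum>m\<in>?S. lscale (c m) (\<Theta> m))"
      unfolding g_def by (rule sum.mono_neutral_right) (use S in auto)
    have gR: "g \<in> R"
      unfolding g using S \<Theta>_R by (intro laurent.subspace_sum[OF R_sub] laurent.subspace_scale[OF R_sub]) auto
    have g0: "g \<noteq> 0" using nz by (simp add: g_def)
    have "?S \<noteq> {}" using g0 unfolding g by (metis sum.empty)
    have \<phi>_set: "{\<phi> f m | m. m \<in> S \<and> c m \<noteq> 0} = \<phi> f ` ?S" by auto
    have \<mu>_le: "\<mu> \<le> \<phi> f m" if "m \<in> ?S" for m
      unfolding \<mu>_def \<phi>_set using S that by (intro Min_le) auto
    have \<mu>_in: "\<mu> \<in> \<phi> f ` ?S"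
      unfolding \<mu>_def \<phi>_set using S \<open>?S \<noteq> {}\<close> by (intro Min_in) auto
    \<comment> \<open>A bound on a single valuation is \<open>R_ge\<close> for the family consisting of it alone.\<close>
    define V where "V k = R_ge R 1 (\<lambda>_. \<nu> f) (\<lambda>_. k)" for k
    have sub: "laurent.subspace (V k)" for k
      unfolding V_def by (rule subspace_R_ge[OF R]) (use valuation triv f in auto)
    have mem: "h \<in> V k \<longleftrightarrow> h \<in> R \<and> Fin k \<le> \<nu> f (Fract h 1)" for h k
      by (auto simp: V_def R_ge_def)
    have \<Theta>_mem: "\<Theta> m \<in> V k" if "m \<in> \<Lambda>" "k \<le> \<phi> f m" for m k
      using \<Theta>_R[OF that(1)] order_trans[OF _ \<nu>_ge[OF f that(1)], of "Fin k"] that(2) by (simp add: mem)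
    have "g \<in> V \<mu>"
      unfolding g using S \<mu>_le \<Theta>_mem
      by (intro laurent.subspace_sum[OF sub] laurent.subspace_scale[OF sub]) auto
    then have ge: "Fin \<mu> \<le> \<nu> f (Fract g 1)" by (simp add: mem)
    have "\<nu> f (Fract g 1) \<le> Fin (\<phi> f (lead g))" by (rule \<nu>_le[OF f gR g0])
    with ge obtain k where k: "\<nu> f (Fract g 1) = Fin k"
      by (cases "\<nu> f (Fract g 1)") auto
    have "?S \<subseteq> {m \<in> \<Lambda>. k \<le> \<phi> f m}"
    proof (rule peel_sum[OF sub[of k], where T = \<Theta> and c = c])
      show "lead h \<in> {m \<in> \<Lambda>. k \<le> \<phi> f m}" if "h \<in> V k" "h \<noteq> 0" for h
        using that lead_in[of h] order_trans[OF _ \<nu>_le[OF f, of h], of "Fin k"] by (auto simp: mem)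
      show "(\<Sum>m\<in>?S. lscale (c m) (\<Theta> m)) \<in> V k"
        using gR k by (simp add: mem flip: g)
    qed (use S monic \<Theta>_mem in auto)
    then have "k \<le> \<mu>" using \<mu>_in by auto
    then show ?thesis using ge k by (simp flip: g_def \<mu>_def)
  qed

  show ?thesis using iso direct min by blast
qed

end
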